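(* Let $X$ be a chain (totally ordered set) and let $F:X^2\to X$ be a quasitrivial nondecreasing operation. Then $F$ is not associative if and only if there are pairwise distinct elements $x,y,z\in X$ satisfying one of the following: (a) $z<x<y$ and $F(x,y)=x$, $F(x,z)=z$, $F(y,z)=y$; (b) $y<x<z$ and $F(x,y)=x$, $F(x,z)=z$, $F(y,z)=y$; (c) $x<z<y$ and $F(x,y)=y$, $F(y,z)=z$, $F(x,z)=x$; (d) $y<z<x$ and $F(x,y)=y$, $F(y,z)=z$, $F(x,z)=x$.
   Context: An operation $F:X^2\to X$ is quasitrivial if $F(x,y)\in\{x,y\}$ for all $x,y\in X$; associative if $F(F(x,y),z)=F(x,F(y,z))$ for all $x,y,z\in X$; nondecreasing if $F(x,y)\le F(x',y')$ whenever $x\le x'$ and $y\le y'$. *)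

theory Defs
  imports Main
begin

definition quasitrivial :: "('a \<Rightarrow> 'a \<Rightarrow> 'a) \<Rightarrow> bool"
  where "quasitrivial F \<longleftrightarrow> (\<forall>x y. F x y \<in> {x, y})"

definition nondecreasing :: "('a::order \<Rightarrow> 'a \<Rightarrow> 'a) \<Rightarrow> bool"
  where "nondecreasing F \<longleftrightarrow> (\<forall>x x' y y'. x \<le> x' \<longrightarrow> y \<le> y' \<longrightarrow> F x y \<le> F x' y')"

text \<open>Associativity of \<open>F\<close> is the library locale predicate \<^const>\<open>semigroup\<close>,
  i.e. \<open>F (F x y) z = F x (F y z)\<close> for all \<open>x\<close>, \<open>y\<close>, \<open>z\<close>.\<close>

end

theory Submission
  imports Defs
begin

text \<open>For quasitrivial \<open>F\<close>, a non-associative triple consists of distinct elements on which \<open>F\<close>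
  behaves cyclically, in one of two ways. Of the six orderings of such a triple, monotonicity
  excludes the four in which \<open>x\<close> (first way), respectively \<open>z\<close> (second way), is not in the middle.\<close>

lemma quasitrivial_not_assoc_iff:
  assumes "quasitrivial F"
  shows "F (F x y) z \<noteq> F x (F y z) \<longleftrightarrow>
    x \<noteq> y \<and> y \<noteq> z \<and> x \<noteq> z \<and>
    ((F x y = x \<and> F x z = z \<and> F y z = y) \<or> (F x y = y \<and> F y z = z \<and> F x z = x))"
proof -
  have qt: "F u v = u \<or> F u v = v" for u v
    using assms by (auto simp: quasitrivial_def)
  show ?thesis
    \<comment> \<open>If \<open>F x y = x\<close> and \<open>F y z = z\<close>, both sides equal
      \<open>F x z\<close>; if \<open>F x y\<close> and \<open>F y z\<close> are both
      \<open>y\<close>, both sides equal \<open>y\<close>. In the two remaining cases one side is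
      \<open>F x z\<close> and the other is \<open>x\<close>, respectively \<open>z\<close>.\<close>
    using qt[of x y] qt[of y z] qt[of x z] qt[of y x] qt[of x x] by auto
qed

lemma nondecreasing_between_fst:
  fixes F :: "'a::linorder \<Rightarrow> 'a \<Rightarrow> 'a"
  assumes "nondecreasing F" and "x \<noteq> y" "y \<noteq> z" "x \<noteq> z"
    and "F x y = x" "F x z = z" "F y z = y"
  shows "z < x \<and> x < y \<or> y < x \<and> x < z"
proof -
  have mono: "F u v \<le> F u' v'" if "u \<le> u'" "v \<le> v'" for u u' v v'
    using assms(1) that by (auto simp: nondecreasing_def)
  \<comment> \<open>Each implication varies one argument only, with \<open>x\<close> fixed on the
    left or \<open>z\<close> on the right, and rules out exactly one order:
    \<open>y < z < x\<close>, \<open>x < z < y\<close>, \<open>x < y < z\<close>,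
    \<open>z < y < x\<close>, in turn.\<close>
  have "y \<le> z \<Longrightarrow> x \<le> z" "z \<le> y \<Longrightarrow> z \<le> x" "x \<le> y \<Longrightarrow> z \<le> y" "y \<le> x \<Longrightarrow> y \<le> z"
    using assms(5-) mono[of x x y z] mono[of x x z y] mono[of x y z z] mono[of y x z z] by auto
  with assms(2-4) show ?thesis
    by (cases x y rule: linorder_cases; cases y z rule: linorder_cases;
        cases x z rule: linorder_cases) auto
qed

text \<open>By duality: swapping the arguments of \<open>F\<close> and reversing the triple turns
  this cyclic pattern into the previous one, with \<open>z\<close> in the role of
  \<open>x\<close>.\<close>

lemma nondecreasing_between_snd:
  fixes F :: "'a::linorder \<Rightarrow> 'a \<Rightarrow> 'a"
  assumes "nondecreasing F" and "x \<noteq> y" "y \<noteq> z" "x \<noteq> z"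
    and "F x y = y" "F y z = z" "F x z = x"
  shows "x < z \<and> z < y \<or> y < z \<and> z < x"
proof -
  have "nondecreasing (\<lambda>u v. F v u)"
    using assms(1) by (auto simp: nondecreasing_def)
  from nondecreasing_between_fst[OF this, of z y x] show ?thesis
    using assms(2-) by auto
qed

theorem lemma3p5:
  fixes F :: "'a::linorder \<Rightarrow> 'a \<Rightarrow> 'a"
  assumes "quasitrivial F" and "nondecreasing F"
  shows "\<not> semigroup F \<longleftrightarrow>
    (\<exists>x y z. x \<noteq> y \<and> y \<noteq> z \<and> x \<noteq> z \<and>
      ((z < x \<and> x < y \<and> F x y = x \<and> F x z = z \<and> F y z = y) \<or>
       (y < x \<and> x < z \<and> F x y = x \<and> F x z = z \<and> F y z = y) \<or>
       (x < z \<and> z < y \<and> F x y = y \<and> F y z = z \<and> F x z = x) \<or>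
       (y < z \<and> z < x \<and> F x y = y \<and> F y z = z \<and> F x z = x)))" (is "_ \<longleftrightarrow> ?rhs")
proof -
  have "\<not> semigroup F \<longleftrightarrow> (\<exists>x y z. F (F x y) z \<noteq> F x (F y z))"
    by (simp add: semigroup_def)
  also have "\<dots> \<longleftrightarrow> (\<exists>x y z. x \<noteq> y \<and> y \<noteq> z \<and> x \<noteq> z \<and>
      ((F x y = x \<and> F x z = z \<and> F y z = y) \<or> (F x y = y \<and> F y z = z \<and> F x z = x)))"
    by (simp only: quasitrivial_not_assoc_iff[OF assms(1)])
  also have "\<dots> \<longleftrightarrow> ?rhs"
    \<comment> \<open>The four disjuncts are the two patterns, each split by its two possible
      orders; the converse forgets the order.\<close>
    using nondecreasing_between_fst[OF assms(2)] nondecreasing_between_snd[OF assms(2)]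
    by (intro ex_cong1 iffI) meson+
  finally show ?thesis .
qed

end
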